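(* Let $A$ be an analytic subgroup of $(\mathbb{R},+)$. (1) If $x$ is a real such that $A+xA=\mathbb{R}$, then there is an additive subgroup $B\subseteq A$ which is an $F_\sigma$ set such that $B+xB=\mathbb{R}$. (2) If the set $\{x\in\mathbb{R}: A+xA=\mathbb{R}\}$ is conull (its complement has Lebesgue measure zero), then there is an additive subgroup $B\subseteq A$ which is an $F_\sigma$ set such that $\{x\in\mathbb{R}: B+xB=\mathbb{R}\}$ is conull.
   Context: A subset of $\mathbb{R}$ is analytic if it is the projection onto the first coordinate of a Borel subset of $\mathbb{R}\times\mathbb{R}$. $A+xA=\{a+xb:a,b\in A\}$. *)

theory Defs
  imports "HOL-Analysis.Analysis"
begin

definition analytic_set :: "real set \<Rightarrow> bool" where
  "analytic_set A \<longleftrightarrow> (\<exists>C :: (real \<times> real) set. C \<in> sets borel \<and> A = fst ` C)"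

definition add_subgroup :: "'a::ab_group_add set \<Rightarrow> bool" where
  "add_subgroup A \<longleftrightarrow>
     0 \<in> A \<and> (\<forall>a\<in>A. \<forall>b\<in>A. a + b \<in> A) \<and> (\<forall>a\<in>A. - a \<in> A)"

definition dilate_sum :: "real set \<Rightarrow> real \<Rightarrow> real set" where
  "dilate_sum A x = {a + x * b | a b. a \<in> A \<and> b \<in> A}"

(* "lebesgue" is the completion of "lborel", so the complement is only required
   to be Lebesgue measurable, not Borel. *)
definition conull :: "real set \<Rightarrow> bool" where
  "conull S \<longleftrightarrow> - S \<in> null_sets lebesgue"

end

theory Submission
  imports Defs "HOL-Probability.Probability"
begin

text \<open>Let \<open>N\<close> be a Borel probability measure on the reals with \<open>A + xA = \<real>\<close> for \<open>N\<close>-almost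
  every \<open>x\<close>, and \<open>U\<close> the uniform measure on \<open>[0,1]\<close>. The set of pairs \<open>(x, y)\<close> with
  \<open>y \<in> A + xA\<close> is analytic of full \<open>N \<Otimes> U\<close> outer measure, so by Choquet's capacitability argument
  there are compact \<open>K m \<subseteq> A\<close> for which the pairs with \<open>y \<in> K m + x (K m)\<close> have measure tending
  to 1. The group \<open>B\<close> generated by all \<open>K m\<close> is sigma-compact, and for \<open>N\<close>-almost every \<open>x\<close> the group
  \<open>B + xB\<close> contains almost all of \<open>[0,1]\<close>, hence is \<open>\<real>\<close>. A point mass \<open>N\<close> gives the first claim
  and a Gaussian \<open>N\<close>, which has the same null sets as Lebesgue measure, the second.\<close>

section \<open>Borel sets as projections of closed sets\<close>

text \<open>\<open>nat => nat\<close> carries the product topology, so it is Baire space; in a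
  Polish space the sets with this property are exactly the analytic ones.\<close>

definition closed_proj :: "'a::topological_space set \<Rightarrow> bool" where
  "closed_proj E \<longleftrightarrow> (\<exists>G :: ('a \<times> (nat \<Rightarrow> nat)) set. closed G \<and> E = fst ` G)"

lemma closed_proj_closed: "closed E \<Longrightarrow> closed_proj E"
  unfolding closed_proj_def
  by (rule exI[of _ "E \<times> UNIV"]) (auto simp: closed_Times)

lemma continuous_on_snd_apply:
  "continuous_on S (\<lambda>p :: 'a::topological_space \<times> ('i \<Rightarrow> 'b::topological_space). snd p i)"
  by (rule continuous_on_product_then_coordinatewise) (rule continuous_on_snd[OF continuous_on_id])

text \<open>The head of a witness sequence selects the index, and its tail is a witness for the set
  with that index.\<close>

lemma closed_proj_UN:
  fixes E :: "nat \<Rightarrow> 'a::topological_space set"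
  assumes "\<And>n. closed_proj (E n)"
  shows "closed_proj (\<Union>n. E n)"
proof -
  obtain G :: "nat \<Rightarrow> ('a \<times> (nat \<Rightarrow> nat)) set"
    where G: "\<And>n. closed (G n)" "\<And>n. E n = fst ` G n"
    using assms unfolding closed_proj_def by metis
  define H where "H = {(x, s). (x, \<lambda>i. s (Suc i)) \<in> G (s 0)}"
  \<comment> \<open>For every \<open>n\<close>: if the head is \<open>n\<close>, then the tail is a
    witness for \<open>E n\<close>. Each condition is closed because \<open>nat\<close> is
    discrete.\<close>
  have "H = (\<Inter>n. (\<lambda>p. snd p 0) -` (- {n}) \<union> (\<lambda>p. (fst p, \<lambda>i. snd p (Suc i))) -` G n)"
    unfolding H_def by (fastforce split: prod.splits)
  moreover have "closed ((\<lambda>p :: 'a \<times> (nat \<Rightarrow> nat). snd p 0) -` (- {n}))" for n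
    by (rule closed_vimage[OF _ continuous_on_snd_apply]) (simp add: closed_def Topological_Spaces.open_discrete)
  moreover have "closed ((\<lambda>p. (fst p, \<lambda>i. snd p (Suc i))) -` G n)" for n
    by (intro closed_vimage G continuous_intros continuous_on_snd_apply)
  ultimately have "closed H"
    by (metis (no_types, lifting) closed_INT closed_Un)
  moreover have "(\<Union>n. E n) = fst ` H"
  proof (intro equalityI subsetI)
    fix x assume "x \<in> (\<Union>n. E n)"
    then obtain n s where "(x, s) \<in> G n" using G(2) by fastforce
    then have "(x, case_nat n s) \<in> H" by (simp add: H_def)
    then show "x \<in> fst ` H" by force
  next
    fix x assume "x \<in> fst ` H"
    then show "x \<in> (\<Union>n. E n)" using G(2) by (force simp: H_def)
  qed
  ultimately show ?thesis unfolding closed_proj_def by blast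
qed

text \<open>One sequence packs countably many: \<open>prod_encode\<close> splits it into rows, row
  \<open>n\<close> being a witness for \<open>E n\<close>.\<close>

lemma closed_proj_INT:
  fixes E :: "nat \<Rightarrow> 'a::topological_space set"
  assumes "\<And>n. closed_proj (E n)"
  shows "closed_proj (\<Inter>n. E n)"
proof -
  obtain G :: "nat \<Rightarrow> ('a \<times> (nat \<Rightarrow> nat)) set"
    where G: "\<And>n. closed (G n)" "\<And>n. E n = fst ` G n"
    using assms unfolding closed_proj_def by metis
  define H where "H = (\<Inter>n. (\<lambda>p. (fst p, \<lambda>i. snd p (prod_encode (n, i)))) -` G n)"
  have "closed ((\<lambda>p. (fst p, \<lambda>i. snd p (prod_encode (n, i)))) -` G n)" for n
    by (intro closed_vimage G continuous_intros continuous_on_snd_apply)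
  then have "closed H"
    unfolding H_def by blast
  moreover have "(\<Inter>n. E n) = fst ` H"
  proof (intro equalityI subsetI)
    fix x assume "x \<in> (\<Inter>n. E n)"
    then have "\<forall>n. \<exists>s. (x, s) \<in> G n" using G(2) by fastforce
    then obtain s where s: "\<And>n. (x, s n) \<in> G n" by metis
    have "(x, \<lambda>k. s (fst (prod_decode k)) (snd (prod_decode k))) \<in> H"
      using s by (simp add: H_def)
    then show "x \<in> fst ` H" by force
  next
    fix x assume "x \<in> fst ` H"
    then show "x \<in> (\<Inter>n. E n)" using G(2) by (force simp: H_def)
  qed
  ultimately show ?thesis unfolding closed_proj_def by blast
qed

lemma closed_proj_open:
  fixes U :: "'a::euclidean_space set"
  assumes "open U"
  shows "closed_proj U"
proof -
  obtain K :: "nat \<Rightarrow> 'a set" where "\<And>n. compact (K n)" "(\<Union>n. K n) = U"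
    using open_Union_compact_subsets[OF assms] by metis
  then show ?thesis
    using closed_proj_UN[of K] closed_proj_closed compact_imp_closed by blast
qed

text \<open>Complements do not preserve \<open>closed_proj\<close> in general, so the induction
  treats a set and its complement together: complementation swaps the two claims, and a countable
  union turns into an intersection on the complement side.\<close>

lemma closed_proj_borel:
  fixes E :: "'a::euclidean_space set"
  assumes "E \<in> sets borel"
  shows "closed_proj E"
proof -
  have "E \<in> sigma_sets UNIV {S. open S}"
    using assms by (simp add: borel_def)
  then have "closed_proj E \<and> closed_proj (- E)"
  proof induction
    case (Basic a)
    then show ?case by (simp add: closed_proj_open closed_proj_closed closed_Compl)
  next
    case Empty
    then show ?case by (simp add: closed_proj_closed)
  next
    case (Compl a)
    then show ?case by (simp add: Compl_eq_Diff_UNIV[symmetric])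
  next
    case (Union a)
    then show ?case by (simp add: closed_proj_UN closed_proj_INT Compl_UN)
  qed
  then show ?thesis ..
qed

section \<open>Approximation from inside\<close>

text \<open>Choquet's capacitability argument: the bounds \<open>s i\<close> are chosen one coordinate at a time,
  keeping the outer measure above \<open>c\<close>; compactness shows that the closures of the resulting
  decreasing sets intersect in the projection of the part of \<open>G\<close> obeying all bounds.\<close>

lemma capacitability:
  fixes G :: "('a::metric_space \<times> 'w::first_countable_topology) set" and b :: "nat \<Rightarrow> 'w \<Rightarrow> nat"
  assumes "finite_measure M" and sets: "sets M = sets borel"
    and "closed G"
    and compact: "\<And>s. compact {w. \<forall>i. b i w \<le> s i}"
    and closed: "\<And>s. closed {w. \<forall>i. b i w \<le> s i}"
    and c: "c < outer_measure_of M (fst ` G)"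
  obtains s P where "P = fst ` (G \<inter> UNIV \<times> {w. \<forall>i. b i w \<le> s i})"
    and "P \<in> sets M" and "c \<le> emeasure M P"
proof -
  interpret finite_measure M by fact
  have space: "space M = UNIV"
    using sets sets_eq_imp_space_eq[OF sets] by simp
  \<comment> \<open>Only the first \<open>n\<close> bounds are imposed. These projections need not
    be measurable, hence the outer measure.\<close>
  define D where "D n s = fst ` {g \<in> G. \<forall>i<n. b i (snd g) \<le> s i}" for n s
  have "\<exists>f. \<forall>n. c < outer_measure_of M (D n (f n)) \<and> (\<forall>i<n. f (Suc n) i = f n i)"
  proof (rule dependent_nat_choice)
    show "\<exists>s. c < outer_measure_of M (D 0 s)"
      using c by (simp add: D_def)
  next
    fix s n assume s: "c < outer_measure_of M (D n s)"
    have "D n s = (\<Union>m. D (Suc n) (s(n := m)))"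
    proof (intro equalityI subsetI)
      fix x assume "x \<in> D n s"
      then obtain g where g: "g \<in> G" "\<forall>i<n. b i (snd g) \<le> s i" "x = fst g"
        unfolding D_def by blast
      then have "x \<in> D (Suc n) (s(n := b n (snd g)))"
        unfolding D_def by (intro image_eqI[of _ _ g]) (auto simp: less_Suc_eq)
      then show "x \<in> (\<Union>m. D (Suc n) (s(n := m)))" by blast
    next
      fix x assume "x \<in> (\<Union>m. D (Suc n) (s(n := m)))"
      then obtain m g where g: "g \<in> G" "\<forall>i<Suc n. b i (snd g) \<le> (s(n := m)) i" "x = fst g"
        unfolding D_def by blast
      have "\<forall>i<n. b i (snd g) \<le> s i"
        using g(2) by (metis fun_upd_apply less_SucI less_irrefl)
      then show "x \<in> D n s"
        unfolding D_def using g by blast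
    qed
    moreover have "incseq (\<lambda>m. D (Suc n) (s(n := m)))"
      unfolding D_def incseq_def by (fastforce simp: less_Suc_eq)
    \<comment> \<open>Outer measure is continuous along increasing sequences of arbitrary sets, so
      some finite bound \<open>m\<close> on coordinate \<open>n\<close> keeps it above
      \<open>c\<close>.\<close>
    ultimately have "outer_measure_of M (D n s)
        = (SUP m. outer_measure_of M (D (Suc n) (s(n := m))))"
      by (simp add: SUP_outer_measure_of_incseq space)
    then obtain m where "c < outer_measure_of M (D (Suc n) (s(n := m)))"
      using s by (auto simp: less_SUP_iff)
    then show "\<exists>s'. c < outer_measure_of M (D (Suc n) s') \<and> (\<forall>i<n. s' i = s i)"
      by (intro exI[of _ "s(n := m)"]) auto
  qed
  then obtain f where f: "\<And>n. c < outer_measure_of M (D n (f n))"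
      "\<And>n i. i < n \<Longrightarrow> f (Suc n) i = f n i"
    by metis
  \<comment> \<open>Diagonal choice: the bound on coordinate \<open>i\<close> is fixed at stage
    \<open>Suc i\<close> and never changed later.\<close>
  define s where "s i = f (Suc i) i" for i
  have fs: "f n i = s i" if "i < n" for n i
    using that
  proof (induction n)
    case (Suc n)
    then show ?case using f(2)[of i n] by (cases "i = n") (auto simp: s_def)
  qed simp
  then have "D n (f n) = D n s" for n
    by (simp add: D_def cong: conj_cong)
  with f have big: "c < outer_measure_of M (D n s)" for n
    by metis
  define P where "P = fst ` (G \<inter> UNIV \<times> {w. \<forall>i. b i w \<le> s i})"
  have anti: "D n s \<subseteq> D m s" if "m \<le> n" for m n
    using that unfolding D_def by fastforce
  \<comment> \<open>Closures are measurable, and passing to them adds nothing in the limit: a point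
    of all closures is a limit of first components from \<open>G\<close>, and compactness makes the
    witnesses converge along a subsequence.\<close>
  have P_eq: "P = (\<Inter>n. closure (D n s))"
  proof (intro equalityI subsetI)
    fix x assume "x \<in> P"
    then have "x \<in> D n s" for n
      unfolding P_def D_def by force
    then show "x \<in> (\<Inter>n. closure (D n s))"
      using closure_subset by blast
  next
    fix x assume x: "x \<in> (\<Inter>n. closure (D n s))"
    have "\<exists>g. g \<in> G \<and> (\<forall>i<n. b i (snd g) \<le> s i) \<and> dist (fst g) x < inverse (Suc n)" for n
    proof -
      have "\<exists>y\<in>D n s. dist y x < inverse (Suc n)"
        using x closure_approachable[of x "D n s"] by (metis INT_E UNIV_I inverse_Suc of_nat_Suc)
      then show ?thesis unfolding D_def by blast
    qed
    then obtain g where g: "\<And>n. g n \<in> G" "\<And>n i. i < n \<Longrightarrow> b i (snd (g n)) \<le> s i"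
        "\<And>n. dist (fst (g n)) x < inverse (Suc n)"
      by metis
    have lim1: "(\<lambda>n. fst (g n)) \<longlonglongrightarrow> x"
    proof (rule metric_LIMSEQ_I)
      fix r :: real assume "0 < r"
      then obtain N where N: "inverse (real (Suc N)) < r" using reals_Archimedean by blast
      have "dist (fst (g n)) x < r" if "N \<le> n" for n
      proof -
        have "inverse (real (Suc n)) \<le> inverse (real (Suc N))"
          using that by (intro le_imp_inverse_le) auto
        then show ?thesis using g(3)[of n] N by linarith
      qed
      then show "\<exists>N. \<forall>n\<ge>N. dist (fst (g n)) x < r" by blast
    qed
    \<comment> \<open>\<open>g n\<close> obeys the bounds only for \<open>i < n\<close>; for each
      \<open>i\<close> the finitely many other terms are absorbed by the \<open>Max\<close>.
      \<open>u 0\<close> bounds the whole sequence and gives compactness, while \<open>u N\<close>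
      agrees with \<open>s\<close> below \<open>N\<close> and bounds the terms from \<open>N\<close>
      on.\<close>
    define u where "u N i = (if i < N then s i else max (s i) (Max ((\<lambda>n. b i (snd (g n))) ` {..i})))" for N i
    have inu: "snd (g n) \<in> {w. \<forall>i. b i w \<le> u N i}" if "N \<le> n" for n N
    proof -
      have "b i (snd (g n)) \<le> u N i" for i
      proof (cases "i < n")
        case True
        then show ?thesis using g(2)[of i n] by (auto simp: u_def intro: le_trans)
      next
        case False
        then have "b i (snd (g n)) \<le> Max ((\<lambda>n. b i (snd (g n))) ` {..i})"
          by (intro Max_ge) auto
        then show ?thesis using False that by (simp add: u_def le_max_iff_disj)
      qed
      then show ?thesis by simp
    qed
    obtain w r where r: "strict_mono r" "((\<lambda>n. snd (g n)) \<circ> r) \<longlonglongrightarrow> w"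
    proof (rule seq_compactE)
      show "seq_compact {w. \<forall>i. b i w \<le> u 0 i}"
        by (rule compact_imp_seq_compact[OF compact])
      show "\<forall>n. snd (g n) \<in> {w. \<forall>i. b i w \<le> u 0 i}"
        using inu[of 0] by blast
    qed
    have "b i w \<le> s i" for i
    proof -
      \<comment> \<open>The tail from \<open>Suc i\<close> on obeys \<open>u (Suc i)\<close>, whose
        entry at \<open>i\<close> is exactly \<open>s i\<close>; closedness passes this to the
        limit.\<close>
      have "w \<in> {w. \<forall>j. b j w \<le> u (Suc i) j}"
      proof (rule closed_sequentially[OF closed])
        show "(\<lambda>n. snd (g (r (n + Suc i)))) \<longlonglongrightarrow> w"
          using LIMSEQ_ignore_initial_segment[OF r(2), of "Suc i"] by (simp add: o_def)
        show "snd (g (r (n + Suc i))) \<in> {w. \<forall>j. b j w \<le> u (Suc i) j}" for n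
          using seq_suble[OF r(1), of "n + Suc i"] by (intro inu) linarith
      qed
      then have "b i w \<le> u (Suc i) i" by simp
      then show ?thesis by (simp add: u_def)
    qed
    moreover have "(x, w) \<in> G"
    proof (rule closed_sequentially[OF \<open>closed G\<close>])
      show "g (r n) \<in> G" for n by (rule g)
      show "(\<lambda>n. g (r n)) \<longlonglongrightarrow> (x, w)"
        using tendsto_Pair[OF LIMSEQ_subseq_LIMSEQ[OF lim1 r(1)] r(2)] by (simp add: o_def)
    qed
    ultimately show "x \<in> P"
      unfolding P_def by force
  qed
  have cl: "closure (D n s) \<in> sets M" for n
    by (simp add: sets)
  have "decseq (\<lambda>n. closure (D n s))"
    unfolding decseq_def using anti by (simp add: closure_mono)
  then have "emeasure M P = (INF n. emeasure M (closure (D n s)))"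
    unfolding P_eq using cl by (subst INF_emeasure_decseq) auto
  moreover have "c \<le> emeasure M (closure (D n s))" for n
  proof -
    have "c \<le> outer_measure_of M (D n s)" using big[of n] by simp
    also have "\<dots> \<le> outer_measure_of M (closure (D n s))"
      by (intro outer_measure_of_mono closure_subset)
    also have "\<dots> = emeasure M (closure (D n s))"
      using cl by simp
    finally show ?thesis .
  qed
  ultimately have "c \<le> emeasure M P"
    by (simp add: INF_greatest)
  moreover have "P \<in> sets M"
    unfolding P_eq using cl by auto
  ultimately show ?thesis
    using that P_def by blast
qed

section \<open>Sigma-compact sets\<close>

lemma fsigma_UN_countable:
  assumes "countable I" "\<And>i. i \<in> I \<Longrightarrow> closed (F i)"
  shows "fsigma (\<Union>i\<in>I. F i)"
proof (cases "I = {}")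
  case True
  then show ?thesis using fsigma.intros[of "\<lambda>_. {}"] by simp
next
  case False
  then have "(\<Union>i\<in>I. F i) = (\<Union>n. F (from_nat_into I n))"
    using assms(1) range_from_nat_into[of I] by (metis image_image)
  then show ?thesis
    using assms False by (metis (mono_tags, lifting) fsigma.intros from_nat_into)
qed

lemma fsigma_UN:
  assumes "countable I" "\<And>i. i \<in> I \<Longrightarrow> fsigma (S i)"
  shows "fsigma (\<Union>i\<in>I. S i)"
proof -
  have "\<exists>F. \<forall>i\<in>I. (\<forall>n::nat. closed (F i n)) \<and> S i = (\<Union>n. F i n)"
    by (intro bchoice ballI) (use assms(2) in \<open>simp add: fsigma.simps, metis\<close>)
  then obtain F where F: "\<And>i n. i \<in> I \<Longrightarrow> closed (F i (n::nat))"
      "\<And>i. i \<in> I \<Longrightarrow> S i = (\<Union>n. F i n)"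
    by metis
  have "(\<Union>i\<in>I. S i) = (\<Union>p\<in>I \<times> UNIV. case p of (i, n) \<Rightarrow> F i n)"
    using F(2) by auto
  then show ?thesis
    using assms(1) F(1) by (auto intro!: fsigma_UN_countable)
qed

lemma fsigma_Times:
  assumes "fsigma S" "fsigma T"
  shows "fsigma (S \<times> T)"
proof -
  obtain F G where "\<And>n::nat. closed (F n)" "S = (\<Union>n. F n)" "\<And>n::nat. closed (G n)" "T = (\<Union>n. G n)"
    using assms by (metis fsigma.cases)
  moreover from this have "S \<times> T = (\<Union>(i, j)\<in>UNIV. F i \<times> G j)" by auto
  ultimately show ?thesis
    by (auto intro!: fsigma_UN_countable closed_Times)
qed

text \<open>Images of closed sets may fail to be closed, but here \<open>S\<close> is a countable
  union of compact sets, whose images are compact and so closed.\<close>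

lemma fsigma_image:
  fixes f :: "'a::{real_normed_vector,heine_borel} \<Rightarrow> 'b::t2_space"
  assumes "fsigma S" "continuous_on UNIV f"
  shows "fsigma (f ` S)"
proof -
  obtain F :: "nat \<Rightarrow> 'a set" where F: "range F \<subseteq> Collect compact" "S = (\<Union>n. F n)"
    using assms(1) fsigma_Union_compact by metis
  then have "f ` S = (\<Union>n. f ` F n)" by auto
  moreover have "closed (f ` F n)" for n
    using F(1) assms(2)
    by (metis compact_continuous_image compact_imp_closed continuous_on_subset image_subset_iff
        mem_Collect_eq subset_UNIV UNIV_I)
  ultimately show ?thesis by (auto intro!: fsigma_UN_countable)
qed

lemma fsigma_imp_borel: "fsigma S \<Longrightarrow> S \<in> sets borel"
  by (induction rule: fsigma.induct) auto

primrec iterated_sum :: "'a::monoid_add set \<Rightarrow> nat \<Rightarrow> 'a set" where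
  "iterated_sum D 0 = {0}"
| "iterated_sum D (Suc n) = (\<lambda>(a, b). a + b) ` (D \<times> iterated_sum D n)"

lemma iterated_sum_add:
  "a \<in> iterated_sum D m \<Longrightarrow> b \<in> iterated_sum D n \<Longrightarrow> a + b \<in> iterated_sum D (m + n)"
  by (induction m arbitrary: a) (force simp: add.assoc)+

text \<open>The group consists of the finite sums of elements of \<open>L\<close> and their
  negatives. For each length these sums form a continuous image of a product of F-sigma
  sets.\<close>

lemma fsigma_generated_subgroup:
  fixes A :: "'a::euclidean_space set"
  assumes "fsigma L" "L \<subseteq> A" "add_subgroup A"
  obtains B where "L \<subseteq> B" "B \<subseteq> A" "add_subgroup B" "fsigma B"
proof -
  define D where "D = L \<union> uminus ` L"
  define B where "B = (\<Union>n. iterated_sum D n)"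
  have "fsigma (\<Union>S\<in>{L, uminus ` L}. S)"
    by (rule fsigma_UN) (auto intro!: fsigma_image assms continuous_intros)
  then have D: "fsigma D" by (simp add: D_def)
  have "fsigma (iterated_sum D n)" for n
  proof (induction n)
    case 0
    then show ?case using fsigma.intros[of "\<lambda>_. {0::'a}"] by simp
  next
    case (Suc n)
    then show ?case
      by (auto intro!: fsigma_image fsigma_Times D continuous_intros simp: case_prod_beta)
  qed
  then have "fsigma B"
    unfolding B_def by (intro fsigma_UN) auto
  moreover have "L \<subseteq> B"
  proof
    fix x assume "x \<in> L"
    then have "x \<in> iterated_sum D (Suc 0)" by (force simp: D_def)
    then show "x \<in> B" unfolding B_def by blast
  qed
  moreover have "iterated_sum D n \<subseteq> A" for n
    using assms(2,3) by (induction n) (auto simp: add_subgroup_def D_def)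
  then have "B \<subseteq> A" unfolding B_def by blast
  moreover have "add_subgroup B"
    unfolding add_subgroup_def
  proof (intro conjI ballI)
    show "0 \<in> B" unfolding B_def by (intro UN_I[of 0]) auto
    show "a + b \<in> B" if "a \<in> B" "b \<in> B" for a b
      using that iterated_sum_add unfolding B_def by blast
    have "- a \<in> iterated_sum D n" if "a \<in> iterated_sum D n" for a n
      using that
    proof (induction n arbitrary: a)
      case (Suc n)
      then obtain d e where "a = d + e" "d \<in> D" "e \<in> iterated_sum D n" by auto
      moreover have "- d \<in> D" using \<open>d \<in> D\<close> by (auto simp: D_def)
      moreover have "- e \<in> iterated_sum D n"
        using Suc.IH \<open>e \<in> iterated_sum D n\<close> .
      ultimately show ?case
        by (auto intro!: image_eqI[of _ _ "(- d, - e)"])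
    qed simp
    then show "- a \<in> B" if "a \<in> B" for a
      using that unfolding B_def by blast
  qed
  ultimately show ?thesis using that by blast
qed

section \<open>Full measure on the unit interval\<close>

lemma add_subgroup_dilate_sum:
  assumes "add_subgroup B"
  shows "add_subgroup (dilate_sum B x)"
  unfolding add_subgroup_def
proof (intro conjI ballI)
  show "0 \<in> dilate_sum B x"
    using assms unfolding dilate_sum_def add_subgroup_def by force
  show "u + v \<in> dilate_sum B x" if "u \<in> dilate_sum B x" "v \<in> dilate_sum B x" for u v
  proof -
    obtain a b c d where "u = a + x * b" "v = c + x * d" "a \<in> B" "b \<in> B" "c \<in> B" "d \<in> B"
      using \<open>u \<in> dilate_sum B x\<close> \<open>v \<in> dilate_sum B x\<close> unfolding dilate_sum_def by blast
    moreover from this have "u + v = (a + c) + x * (b + d)" by (simp add: algebra_simps)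
    ultimately show ?thesis using assms unfolding dilate_sum_def add_subgroup_def by blast
  qed
  show "- u \<in> dilate_sum B x" if "u \<in> dilate_sum B x" for u
  proof -
    obtain a b where "u = a + x * b" "a \<in> B" "b \<in> B"
      using \<open>u \<in> dilate_sum B x\<close> unfolding dilate_sum_def by blast
    moreover from this have "- u = (- a) + x * (- b)" by simp
    ultimately show ?thesis using assms unfolding dilate_sum_def add_subgroup_def by blast
  qed
qed

lemma AE_lborel_translation:
  fixes t :: real
  assumes "AE y in lborel. P y"
  shows "AE y in lborel. P (t + y)"
proof -
  have "AE y in distr lborel borel ((+) t). P y"
    using assms by (subst lborel_distr_plus)
  then show ?thesis
    by (rule AE_distrD[rotated]) simp
qed

text \<open>A Steinhaus-type argument: differences of elements of \<open>H\<close> fill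
  \<open>[0,1/2]\<close>, and integer multiples and negation then reach every real.\<close>

lemma add_subgroup_eq_UNIV:
  fixes H :: "real set"
  assumes H: "add_subgroup H" and AE: "AE y in lborel. y \<in> {0..1} \<longrightarrow> y \<in> H"
  shows "H = UNIV"
proof -
  \<comment> \<open>\<open>H\<close> and its translate by \<open>- t\<close> both contain almost all of \<open>[0,1/2]\<close>, so they meet there.\<close>
  have small: "t \<in> H" if "0 \<le> t" "t \<le> 1/2" for t
  proof -
    have "AE y in lborel. (y \<in> {0..1} \<longrightarrow> y \<in> H) \<and> (t + y \<in> {0..1} \<longrightarrow> t + y \<in> H)"
      using AE AE_lborel_translation[OF AE, of t] by eventually_elim simp
    then have "AE y in lborel. y \<in> {0..1/2} \<longrightarrow> y \<in> H \<and> t + y \<in> H"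
      by eventually_elim (use that in auto)
    moreover have "\<not> (AE y in lborel. y \<notin> {0..1/2::real})"
      by (subst AE_iff_null_sets[symmetric]) (auto simp: null_sets_def)
    ultimately obtain y where "y \<in> H" "t + y \<in> H"
      by (smt (verit, best) eventually_elim2 eventually_mono)
    then have "(t + y) + (- y) \<in> H"
      using H unfolding add_subgroup_def by blast
    then show ?thesis by simp
  qed
  have mult: "real n * t \<in> H" if "t \<in> H" for n t
    using that H by (induction n) (auto simp: add_subgroup_def algebra_simps)
  have nonneg: "y \<in> H" if "0 \<le> y" for y
  proof -
    \<comment> \<open>This puts \<open>y / Suc n\<close> into \<open>[0,1/2]\<close>; using
      \<open>Suc n\<close> keeps the denominator nonzero.\<close>
    obtain n where n: "2 * y \<le> real n" using real_arch_simple by blast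
    have "real (Suc n) * (y / real (Suc n)) \<in> H"
      by (intro mult small) (use that n in \<open>auto simp: field_simps\<close>)
    then show ?thesis by simp
  qed
  have "y \<in> H" for y
    using nonneg[of y] nonneg[of "- y"] H unfolding add_subgroup_def
    by (metis linear minus_minus neg_0_le_iff_le)
  then show ?thesis by blast
qed

section \<open>Capacitability for sums of dilates\<close>

lemma closed_bounded_sequences: "closed {t :: nat \<Rightarrow> nat. \<forall>i. t i \<le> u i}"
  by (intro closed_Collect_all closed_Collect_le continuous_on_product_coordinates continuous_on_const)

lemma compact_bounded_sequences: "compact {t :: nat \<Rightarrow> nat. \<forall>i. t i \<le> u i}"
proof -
  have "compactin (product_topology (\<lambda>i. euclidean) UNIV) (PiE UNIV (\<lambda>i::nat. {..u i}))"
    by (simp add: compactin_PiE finite_imp_compact)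
  moreover have "PiE UNIV (\<lambda>i::nat. {..u i}) = {t. \<forall>i. t i \<le> u i}"
    by (auto simp: PiE_UNIV_domain)
  ultimately show ?thesis
    by (simp add: euclidean_product_topology)
qed

text \<open>Choquet's argument is applied with pairs of points of \<open>C\<close> as witnesses, one
  point per summand. The bounds confine both points to one compact set, whose part in
  \<open>C\<close> projects onto \<open>K\<close>.\<close>

lemma analytic_dilate_sum_capacitability:
  assumes "analytic_set A" and "finite_measure M" and sets: "sets M = sets borel"
    and c: "c < outer_measure_of M {(x, y). y \<in> dilate_sum A x}"
  obtains K where "compact K" "K \<subseteq> A"
    "{(x, y). y \<in> dilate_sum K x} \<in> sets M" "c \<le> emeasure M {(x, y). y \<in> dilate_sum K x}"
proof -
  obtain E :: "(real \<times> real) set" where "E \<in> sets borel" "A = fst ` E"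
    using assms(1) unfolding analytic_set_def by blast
  moreover from this obtain C :: "((real \<times> real) \<times> (nat \<Rightarrow> nat)) set"
    where C: "closed C" "E = fst ` C"
    using closed_proj_borel unfolding closed_proj_def by blast
  ultimately have A: "A = (\<lambda>z. fst (fst z)) ` C"
    by (simp add: image_image)
  \<comment> \<open>Entry 0 bounds the norm of the point in the plane, entry \<open>Suc j\<close>
    bounds term \<open>j\<close> of the sequence; bounding all entries leaves a compact set.\<close>
  define h :: "nat \<Rightarrow> (real \<times> real) \<times> (nat \<Rightarrow> nat) \<Rightarrow> nat"
    where "h i z = (case i of 0 \<Rightarrow> nat \<lceil>norm (fst z)\<rceil> | Suc j \<Rightarrow> snd z j)" for i z
  \<comment> \<open>The maximum imposes the same bounds on both witnesses, so that a single
    \<open>K\<close> serves for both summands.\<close>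
  define b where "b i w = max (h i (fst w)) (h i (snd w))" for i w
  define Q where "Q s = {z. \<forall>i. h i z \<le> s i}" for s
  define G where "G = {p. fst (snd p) \<in> C \<and> snd (snd p) \<in> C
    \<and> snd (fst p) = fst (fst (fst (snd p))) + fst (fst p) * fst (fst (snd (snd p)))}"
  have Q_eq: "Q s = cball 0 (real (s 0)) \<times> {t. \<forall>i. t i \<le> s (Suc i)}" for s
  proof -
    have *: "(\<forall>i. P i) \<longleftrightarrow> P 0 \<and> (\<forall>i. P (Suc i))" for P :: "nat \<Rightarrow> bool"
      by (metis not0_implies_Suc)
    have "nat \<lceil>r\<rceil> \<le> n \<longleftrightarrow> r \<le> real n" for r :: real and n
      by linarith
    then show ?thesis
      unfolding Q_def h_def by (subst *) auto
  qed
  have Q: "compact (Q s)" "closed (Q s)" for s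
    unfolding Q_eq by (simp_all add: compact_Times compact_bounded_sequences
        closed_Times closed_bounded_sequences)
  have b: "{w. \<forall>i. b i w \<le> s i} = Q s \<times> Q s" for s
    by (auto simp: b_def Q_def)
  have "closed ({p. fst (snd p) \<in> C} \<inter> {p. snd (snd p) \<in> C}
    \<inter> {p. snd (fst p) = fst (fst (fst (snd p))) + fst (fst p) * fst (fst (snd (snd p)))})"
    using C(1)
    by (intro closed_Int closed_Collect_eq continuous_intros closed_vimage[unfolded vimage_def])
  then have "closed G"
    by (simp add: G_def Collect_conj_eq Int_assoc)
  \<comment> \<open>\<open>Z = UNIV\<close> gives the pairs belonging to \<open>A\<close>, and
    \<open>Z = Q s\<close> those belonging to the compact set.\<close>
  have G: "fst ` (G \<inter> UNIV \<times> (Z \<times> Z)) = {(x, y). y \<in> dilate_sum ((\<lambda>z. fst (fst z)) ` (C \<inter> Z)) x}"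
    for Z
  proof (intro equalityI subsetI)
    fix p assume "p \<in> fst ` (G \<inter> UNIV \<times> (Z \<times> Z))"
    then obtain z z' where "z \<in> C \<inter> Z" "z' \<in> C \<inter> Z" "snd p = fst (fst z) + fst p * fst (fst z')"
      by (auto simp: G_def)
    then show "p \<in> {(x, y). y \<in> dilate_sum ((\<lambda>z. fst (fst z)) ` (C \<inter> Z)) x}"
      unfolding dilate_sum_def case_prod_beta by blast
  next
    fix p assume "p \<in> {(x, y). y \<in> dilate_sum ((\<lambda>z. fst (fst z)) ` (C \<inter> Z)) x}"
    then obtain z z' where "z \<in> C \<inter> Z" "z' \<in> C \<inter> Z" "snd p = fst (fst z) + fst p * fst (fst z')"
      unfolding dilate_sum_def by auto
    then show "p \<in> fst ` (G \<inter> UNIV \<times> (Z \<times> Z))"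
      by (intro image_eqI[of _ _ "(p, z, z')"]) (auto simp: G_def)
  qed
  have b_compact: "compact {w. \<forall>i. b i w \<le> s i}" and b_closed: "closed {w. \<forall>i. b i w \<le> s i}" for s
    unfolding b by (intro compact_Times closed_Times Q)+
  have "c < outer_measure_of M (fst ` G)"
    using c G[of UNIV] A by simp
  then obtain s P where P: "P = fst ` (G \<inter> UNIV \<times> {w. \<forall>i. b i w \<le> s i})"
      "P \<in> sets M" "c \<le> emeasure M P"
    by (rule capacitability[OF assms(2) sets \<open>closed G\<close> b_compact b_closed])
  show ?thesis
  proof
    show "compact ((\<lambda>z. fst (fst z)) ` (C \<inter> Q s))"
      by (intro compact_continuous_image continuous_intros closed_Int_compact C Q)
    show "(\<lambda>z. fst (fst z)) ` (C \<inter> Q s) \<subseteq> A"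
      using A by blast
  qed (use P b G in simp_all)
qed

text \<open>Supplies the measurability that Fubini's theorem needs for the group
  \<open>B\<close>.\<close>

lemma fsigma_dilate_sum_graph:
  assumes "fsigma B"
  shows "fsigma {(x, y). y \<in> dilate_sum B x}"
proof -
  have "{(x, y). y \<in> dilate_sum B x} = (\<lambda>(x, a, b). (x, a + x * b)) ` (UNIV \<times> B \<times> B)"
    unfolding dilate_sum_def by force
  then show ?thesis
    by (auto intro!: fsigma_image fsigma_Times assms continuous_intros simp: case_prod_beta)
qed

section \<open>The F-sigma subgroup for a general probability measure\<close>

lemma exists_fsigma_subgroup_AE:
  assumes A: "analytic_set A" "add_subgroup A"
    and "prob_space N" and sets_N: "sets N = sets borel"
    and AE: "AE x in N. dilate_sum A x = UNIV"
  obtains B where "B \<subseteq> A" "add_subgroup B" "fsigma B" "AE x in N. dilate_sum B x = UNIV"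
proof -
  interpret N: prob_space N by fact
  define U where "U = uniform_measure lborel {0..1::real}"
  interpret U: prob_space U
    unfolding U_def by (rule prob_space_uniform_measure) auto
  interpret NU: pair_prob_space N U ..
  define M where "M = N \<Otimes>\<^sub>M U"
  interpret M: prob_space M
    unfolding M_def by (intro prob_space_pair N.prob_space_axioms U.prob_space_axioms)
  have sets_U: "sets U = sets borel"
    by (simp add: U_def)
  have sets_M: "sets M = sets borel"
    unfolding M_def borel_prod[symmetric] by (intro sets_pair_measure_cong sets_N sets_U)
  \<comment> \<open>The pairs for \<open>A\<close> need not form a measurable set, but a measurable
    \<open>E\<close> containing them has full sections over \<open>N\<close>-almost every
    \<open>x\<close>, so it has measure 1 by Fubini.\<close>
  have "1 \<le> outer_measure_of M {(x, y). y \<in> dilate_sum A x}"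
    unfolding outer_measure_of_def
  proof (rule INF_greatest, safe)
    fix E assume E: "E \<in> sets M" "{(x, y). y \<in> dilate_sum A x} \<subseteq> E"
    have "AE x in N. AE y in U. (x, y) \<in> E"
      using AE by eventually_elim (use E(2) in auto)
    moreover have "{p \<in> space M. p \<in> E} \<in> sets M"
      using E(1) by simp
    ultimately have "AE p in M. p \<in> E"
      unfolding M_def by (subst NU.AE_pair_measure) auto
    then show "1 \<le> emeasure M E"
      using E(1) by (simp add: M.emeasure_eq_1_AE)
  qed
  \<comment> \<open>Capacitability asks for a bound strictly below the outer measure; these bounds
    tend to 1.\<close>
  moreover have "ennreal (1 - inverse (real (Suc m))) < 1" for m
    by (simp add: ennreal_less_one_iff)
  ultimately have c: "ennreal (1 - inverse (real (Suc m)))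
      < outer_measure_of M {(x, y). y \<in> dilate_sum A x}" for m
    by (rule less_le_trans[rotated])
  have "\<exists>K. compact K \<and> K \<subseteq> A \<and> {(x, y). y \<in> dilate_sum K x} \<in> sets M
      \<and> ennreal (1 - inverse (real (Suc m))) \<le> emeasure M {(x, y). y \<in> dilate_sum K x}" for m
    by (rule analytic_dilate_sum_capacitability[OF A(1) M.finite_measure_axioms sets_M c[of m]])
      blast
  then obtain K where K: "\<And>m. compact (K m)" "\<And>m. K m \<subseteq> A"
      "\<And>m. {(x, y). y \<in> dilate_sum (K m) x} \<in> sets M"
      "\<And>m. ennreal (1 - inverse (real (Suc m))) \<le> emeasure M {(x, y). y \<in> dilate_sum (K m) x}"
    by metis
  have "fsigma (\<Union>m. K m)"
    using K(1) by (intro fsigma.intros compact_imp_closed)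
  moreover have "(\<Union>m. K m) \<subseteq> A" using K(2) by blast
  ultimately obtain B where B: "(\<Union>m. K m) \<subseteq> B" "B \<subseteq> A" "add_subgroup B" "fsigma B"
    using fsigma_generated_subgroup A(2) by metis
  define E where "E = {(x, y). y \<in> dilate_sum B x}"
  have E: "E \<in> sets M"
    unfolding E_def sets_M using B(4) by (intro fsigma_imp_borel fsigma_dilate_sum_graph)
  \<comment> \<open>As \<open>B\<close> contains every \<open>K m\<close>, the single set
    \<open>E\<close> satisfies all the lower bounds at once.\<close>
  have "1 - inverse (real (Suc m)) \<le> measure M E" for m
  proof -
    have "{(x, y). y \<in> dilate_sum (K m) x} \<subseteq> E"
      unfolding E_def dilate_sum_def using B(1) by blast
    then have "ennreal (1 - inverse (real (Suc m))) \<le> ennreal (measure M E)"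
      using K(4)[of m] emeasure_mono[OF _ E] by (metis M.emeasure_eq_measure order_trans)
    then show ?thesis by simp
  qed
  moreover have "(\<lambda>m. 1 - inverse (real (Suc m))) \<longlonglongrightarrow> 1 - 0"
    by (intro tendsto_intros LIMSEQ_inverse_real_of_nat)
  ultimately have "1 - 0 \<le> measure M E"
    by (intro LIMSEQ_le_const2) auto
  then have "AE p in M. p \<in> E"
    using M.prob_le_1[of E] E by (intro M.AE_prob_1) simp
  \<comment> \<open>Fubini in the other direction: almost every section of \<open>E\<close> contains
    almost all of \<open>[0,1]\<close>, which suffices for a group.\<close>
  then have "AE x in N. AE y in U. (x, y) \<in> E"
    unfolding M_def by (rule NU.AE_pair)
  then have "AE x in N. dilate_sum B x = UNIV"
  proof eventually_elim
    case (elim x)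
    then have "AE y in lborel. y \<in> {0..1} \<longrightarrow> y \<in> dilate_sum B x"
      unfolding U_def E_def by (subst (asm) AE_uniform_measure) auto
    then show ?case
      by (intro add_subgroup_eq_UNIV add_subgroup_dilate_sum B(3))
  qed
  then show ?thesis using that B by blast
qed

section \<open>Gaussian measure and point masses\<close>

text \<open>The density is strictly positive, so the null sets are those of \<open>lborel\<close>;
  being null for the completion means lying inside a Borel null set, which is what \<open>AE\<close>
  expresses.\<close>

lemma AE_std_normal_iff_conull:
  "(AE x in density lborel std_normal_density. x \<in> S) \<longleftrightarrow> conull S"
proof -
  have "(AE x in density lborel std_normal_density. x \<in> S) \<longleftrightarrow> (AE x in lborel. x \<in> S)"
    by (subst AE_density) (auto simp: normal_density_pos)
  also have "\<dots> \<longleftrightarrow> conull S"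
    by (simp add: conull_def null_sets_completion_iff2 eventually_ae_filter Compl_eq)
  finally show ?thesis .
qed

theorem theorem3p12:
  fixes A :: "real set"
  assumes "analytic_set A" and "add_subgroup A"
  shows "(\<forall>x::real. dilate_sum A x = UNIV \<longrightarrow>
            (\<exists>B. B \<subseteq> A \<and> add_subgroup B \<and> fsigma B \<and> dilate_sum B x = UNIV))
       \<and> (conull {x. dilate_sum A x = UNIV} \<longrightarrow>
            (\<exists>B. B \<subseteq> A \<and> add_subgroup B \<and> fsigma B \<and> conull {x. dilate_sum B x = UNIV}))"
proof (intro conjI allI impI)
  fix x assume x: "dilate_sum A x = UNIV"
  have prob: "prob_space (return borel x)"
    by (rule prob_space_return) simp
  have "AE y in return borel x. y = x"
    by (subst AE_return) auto
  then have "AE y in return borel x. dilate_sum A y = UNIV"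
    by eventually_elim (simp add: x)
  then obtain B where B: "B \<subseteq> A" "add_subgroup B" "fsigma B"
      "AE y in return borel x. dilate_sum B y = UNIV"
    using exists_fsigma_subgroup_AE[OF assms prob] by auto
  \<comment> \<open>The predicate no longer depends on \<open>y\<close>, and a constant that holds
    almost everywhere in a probability space is true.\<close>
  have "AE y in return borel x. dilate_sum B x = UNIV"
    using B(4) \<open>AE y in return borel x. y = x\<close> by eventually_elim simp
  then have "dilate_sum B x = UNIV"
    using prob_space.AE_False[OF prob] by (cases "dilate_sum B x = UNIV") auto
  with B show "\<exists>B. B \<subseteq> A \<and> add_subgroup B \<and> fsigma B \<and> dilate_sum B x = UNIV"
    by blast
next
  assume "conull {x. dilate_sum A x = UNIV}"
  then have "AE x in density lborel std_normal_density. dilate_sum A x = UNIV"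
    by (simp add: AE_std_normal_iff_conull[symmetric])
  moreover have "prob_space (density lborel std_normal_density)"
    by (rule prob_space_normal_density) simp
  ultimately obtain B where "B \<subseteq> A" "add_subgroup B" "fsigma B"
      "AE x in density lborel std_normal_density. dilate_sum B x = UNIV"
    using exists_fsigma_subgroup_AE[OF assms] by (metis sets_density sets_lborel)
  moreover from this have "conull {x. dilate_sum B x = UNIV}"
    by (simp add: AE_std_normal_iff_conull[symmetric])
  ultimately show "\<exists>B. B \<subseteq> A \<and> add_subgroup B \<and> fsigma B \<and> conull {x. dilate_sum B x = UNIV}"
    by blast
qed

end
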